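(* Let $\mathcal C\subset\mathbb{P}^{n-1}$ be the real polyhedral cone generated by $v^1,\dots,v^p\in\mathbb{R}^n$. If $a$ is an $(I,j)$-vertex of $\mathcal C$ which satisfies: for each $i\in I$, $S_i(a)\cap S_j(a)\not\subset\bigcup_{k\in[n]\setminus\{i,j\}}S_k(a)$, then $a$ is a non-redundant apex of $\mathcal C$, i.e. $a\in\mathcal A$.
   Context: Max-plus semiring $\mathbb{R}_{\max}=\mathbb{R}\cup\{-\infty\}$ with $\oplus=\max$, $\otimes=+$; on $\mathbb{R}_{\max}^n$, componentwise maximum and $\lambda x=(\lambda+x_1,\dots,\lambda+x_n)$. $\mathcal C=\{\lambda_1v^1\oplus\dots\oplus\lambda_pv^p:\lambda_r\in\mathbb{R}_{\max}\}$, identified with its image in $\mathbb{P}^{n-1}=\mathbb{R}^n/\mathbb{R}(1,\dots,1)$ (usual topology; $\partial\mathcal C$ its boundary). For $b\in\mathbb{R}^n$ and non-empty proper $K\subsetneq[n]$, $\mathcal H(b,K)=\{x\in\mathbb{R}_{\max}^n\setminus\{(-\infty,\dots,-\infty)\}:\max_{i\in K}(x_i-b_i)\ge\max_{l\notin K}(x_l-b_l)\}$ (modulo constants), with apex $b$. $\Sigma$ is the set of all $\mathcal H(b,K)$ with $\mathcal C\subset\mathcal H(b,K)$ and $b\in\mathcal C$; $\tau(\Gamma)=\{\mathcal H\in\Sigma:\bigcap_{\mathcal H'\in\Gamma}\mathcal H'\subset\mathcal H\}$ ($\tau(\emptyset)=\emptyset$); $\Sigma_b=\{\mathcal H(b,K):\mathcal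 C\subset\mathcal H(b,K)\}$; $\tau'(X)=\{b\in\partial\mathcal C:\Sigma_b\subset\tau(\bigcup_{c\in X}\Sigma_c)\}$; the set $\mathcal A$ of non-redundant apices is the unique inclusion-minimal finite $X\subset\partial\mathcal C$ with $\tau'(X)=\partial\mathcal C$. The type of $x\in\mathbb{R}^n$ relative to $v^1,\dots,v^p$ is $(S_1(x),\dots,S_n(x))$ with $S_l(x)=\{r\in[p]:v^r_l-x_l\ge v^r_i-x_i\ \forall i\in[n]\}$. For non-empty proper $I\subsetneq[n]$ and $j\notin I$, $a\in\mathbb{P}^{n-1}$ is an $(I,j)$-vertex of $\mathcal C$ if: (C1) $\bigcup_{i\in I}S_i(a)=[p]$; (C2) for each $k\notin I$ there is $i\in I$ with $S_i(a)\cap S_k(a)\neq\emptyset$; (C4) for each $i\in I$, $S_i(a)\cap S_j(a)\not\subset\bigcup_{k\in I\setminus\{i\}}S_k(a)$. *)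

theory Defs
  imports "HOL-Analysis.Analysis"
begin

text \<open>
  The max-plus semiring is the set of all \<^typ>\<open>ereal\<close> other than \<open>\<infinity>\<close>, with maximum as
  addition and \<open>+\<close> as multiplication.
\<close>

definition rmax_vecs :: "(ereal^'n) set" where
  "rmax_vecs = {x. \<forall>i. x $ i \<noteq> \<infinity>}"

definition bot_vec :: "ereal^'n" where
  "bot_vec = (\<chi> i. -\<infinity>)"

definition emb :: "real^'n \<Rightarrow> ereal^'n" where
  "emb x = (\<chi> i. ereal (x $ i))"


subsection \<open>Tropical projective space\<close>

definition shift_equiv :: "real^'n \<Rightarrow> real^'n \<Rightarrow> bool" where
  "shift_equiv x y \<longleftrightarrow> (\<exists>t. \<forall>i. y $ i = t + x $ i)"

lemma equivp_shift_equiv: "equivp (shift_equiv :: real^'n \<Rightarrow> real^'n \<Rightarrow> bool)"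
proof (rule equivpI)
  show "reflp (shift_equiv :: real^'n \<Rightarrow> real^'n \<Rightarrow> bool)"
    unfolding shift_equiv_def by (intro reflpI exI[of _ 0]) simp
  show "symp (shift_equiv :: real^'n \<Rightarrow> real^'n \<Rightarrow> bool)"
  proof (rule sympI)
    fix x y :: "real^'n"
    assume "shift_equiv x y"
    then obtain t where "\<forall>i. y $ i = t + x $ i"
      unfolding shift_equiv_def by blast
    then show "shift_equiv y x"
      unfolding shift_equiv_def by (intro exI[of _ "- t"]) simp
  qed
  show "transp (shift_equiv :: real^'n \<Rightarrow> real^'n \<Rightarrow> bool)"
  proof (rule transpI)
    fix x y z :: "real^'n"
    assume "shift_equiv x y" "shift_equiv y z"
    then obtain s t where "\<forall>i. y $ i = s + x $ i" "\<forall>i. z $ i = t + y $ i"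
      unfolding shift_equiv_def by blast
    then show "shift_equiv x z"
      unfolding shift_equiv_def by (intro exI[of _ "t + s"]) simp
  qed
qed

quotient_type 'n tproj = "real^('n::finite)" / shift_equiv
  morphisms rep_tproj proj
  by (rule equivp_shift_equiv)

text \<open>The quotient topology of \<open>\<real>\<^sup>n\<close> by \<open>\<real>(1,\<dots>,1)\<close>.\<close>

instantiation tproj :: (finite) topological_space
begin

definition open_tproj :: "'a tproj set \<Rightarrow> bool" where
  "open_tproj U \<longleftrightarrow> open (proj -` U)"

instance
  by standard (auto simp: open_tproj_def vimage_Int vimage_Union intro: open_Int)

end


subsection \<open>Cones and half-spaces\<close>

definition tcone :: "('p::finite \<Rightarrow> real^'n) \<Rightarrow> (ereal^'n) set" where
  "tcone v = {(\<chi> i. MAX r. \<mu> r + ereal (v r $ i)) | \<mu>. \<forall>r. \<mu> r \<noteq> \<infinity>}"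

text \<open>
  As the generators are real, every point of the cone other than \<^const>\<open>bot_vec\<close> is real; thus
  the following is the whole image of the cone modulo constants.
\<close>

definition tcone_proj :: "('p::finite \<Rightarrow> real^'n) \<Rightarrow> 'n tproj set" where
  "tcone_proj v = {proj x | x. emb x \<in> tcone v}"

text \<open>
  Half-spaces (used only for \<open>K\<close> non-empty and proper) are invariant under adding constants.
  They are therefore kept as sets of representatives, for which inclusions and intersections are
  the same as for the sets of classes.
\<close>

definition halfspace :: "real^'n \<Rightarrow> 'n set \<Rightarrow> (ereal^'n) set" where
  "halfspace b K = {x \<in> rmax_vecs - {bot_vec}.
     (MAX i\<in>K. x $ i - ereal (b $ i)) \<ge> (MAX l\<in>-K. x $ l - ereal (b $ l))}"

definition Sigma_all :: "('p::finite \<Rightarrow> real^'n) \<Rightarrow> (ereal^'n) set set" where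
  "Sigma_all v = {halfspace b K | b K. K \<noteq> {} \<and> K \<noteq> UNIV \<and>
     tcone v - {bot_vec} \<subseteq> halfspace b K \<and> proj b \<in> tcone_proj v}"

definition Sigma_at :: "('p::finite \<Rightarrow> real^'n) \<Rightarrow> 'n tproj \<Rightarrow> (ereal^'n) set set" where
  "Sigma_at v c = {halfspace b K | b K. proj b = c \<and> K \<noteq> {} \<and> K \<noteq> UNIV \<and>
     tcone v - {bot_vec} \<subseteq> halfspace b K}"


subsection \<open>Non-redundant apices\<close>

definition tau :: "('p::finite \<Rightarrow> real^'n) \<Rightarrow> (ereal^'n) set set \<Rightarrow> (ereal^'n) set set" where
  "tau v \<Gamma> = {H \<in> Sigma_all v. \<Inter>\<Gamma> \<subseteq> H}"

lemma tau_empty: "tau v {} = {}"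
proof -
  have "bot_vec \<notin> H" if "H \<in> Sigma_all v" for H
    using that by (auto simp: Sigma_all_def halfspace_def)
  then show ?thesis
    unfolding tau_def by auto
qed

definition tau' :: "('p::finite \<Rightarrow> real^'n) \<Rightarrow> 'n tproj set \<Rightarrow> 'n tproj set" where
  "tau' v X = {b \<in> frontier (tcone_proj v). Sigma_at v b \<subseteq> tau v (\<Union>c\<in>X. Sigma_at v c)}"

definition apex_generating :: "('p::finite \<Rightarrow> real^'n) \<Rightarrow> 'n tproj set \<Rightarrow> bool" where
  "apex_generating v X \<longleftrightarrow>
     finite X \<and> X \<subseteq> frontier (tcone_proj v) \<and> tau' v X = frontier (tcone_proj v)"

definition nonredundant_apices :: "('p::finite \<Rightarrow> real^'n) \<Rightarrow> 'n tproj set" where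
  "nonredundant_apices v =
     (THE X. apex_generating v X \<and> (\<forall>Y. apex_generating v Y \<and> Y \<subseteq> X \<longrightarrow> Y = X))"


subsection \<open>Types and vertices\<close>

definition type_set :: "('p \<Rightarrow> real^'n) \<Rightarrow> 'n \<Rightarrow> real^'n \<Rightarrow> 'p set" where
  "type_set v l x = {r. \<forall>i. v r $ l - x $ l \<ge> v r $ i - x $ i}"

text \<open>
  Both \<^const>\<open>type_set\<close> and the next predicate are invariant under adding a constant to the
  point, so they are stated for a representative \<open>a \<in> \<real>\<^sup>n\<close> of a projective point.
\<close>

definition is_vertex :: "('p \<Rightarrow> real^'n) \<Rightarrow> 'n set \<Rightarrow> 'n \<Rightarrow> real^'n \<Rightarrow> bool" where
  "is_vertex v I j a \<longleftrightarrow>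
     I \<noteq> {} \<and> I \<noteq> UNIV \<and> j \<notin> I \<and>
     (\<Union>i\<in>I. type_set v i a) = UNIV \<and>
     (\<forall>k. k \<notin> I \<longrightarrow> (\<exists>i\<in>I. type_set v i a \<inter> type_set v k a \<noteq> {})) \<and>
     (\<forall>i\<in>I. \<not> type_set v i a \<inter> type_set v j a \<subseteq> (\<Union>k\<in>I - {i}. type_set v k a))"

end

theory Submission
  imports Defs
begin

text \<open>
  For small \<open>\<epsilon> > 0\<close> the point \<open>a + \<epsilon> e\<^sub>j\<close> lies outside \<open>\<H>(a, I)\<close>, but inside every half-space
  containing the cone whose apex \<open>b\<close> is another point of the cone: if \<open>\<H>(b, K)\<close> cut it off, then
  \<open>j \<notin> K\<close> would be an index maximizing \<open>a - b\<close>, the generators tied exactly at \<open>i\<close> and \<open>j\<close> would make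
  every \<open>i \<in> I\<close> maximize \<open>a - b\<close> as well, and then \<open>b \<in> \<H>(a, I)\<close> forces \<open>a - b\<close> to be constant. So
  every finite generating set of apices contains \<open>a\<close>.

  The set of non-redundant apices is well defined: a finite generating set consists of the apices in
  the cone at which the coordinates are linked by ties, and minimal generating sets coincide by an
  anti-exchange property, proved by walking from a point alternately towards two apices.
\<close>

section \<open>Reduction to real points\<close>

text \<open>Residuation: a real point lies in the cone iff each of its coordinates is attained by a
  generator shifted as high as possible below the point.\<close>

definition rcone :: "('p \<Rightarrow> real^'n) \<Rightarrow> (real^'n) set" where
  "rcone v = {x. \<forall>l. type_set v l x \<noteq> {}}"

text \<open>Letting \<open>l\<close> range over all indices, not only those outside
  \<open>K\<close>, makes \<open>i\<close> a global maximizer of \<open>x - b\<close>; for nonempty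
  \<open>K\<close> the condition is the same.\<close>

definition rhalf :: "real^'n \<Rightarrow> 'n set \<Rightarrow> (real^'n) set" where
  "rhalf b K = {x. \<exists>i\<in>K. \<forall>l. x $ l - b $ l \<le> x $ i - b $ i}"

text \<open>Containment of the cone in the half-space, tested on generators: \<open>v r\<close> lies
  in it iff \<open>v r - b\<close> attains its maximum in \<open>K\<close>.\<close>

definition valid :: "('p \<Rightarrow> real^'n) \<Rightarrow> real^'n \<Rightarrow> 'n set \<Rightarrow> bool" where
  "valid v b K \<longleftrightarrow> K \<noteq> {} \<and> K \<noteq> UNIV \<and> (\<forall>r. \<exists>i\<in>K. r \<in> type_set v i b)"

text \<open>The real part of the intersection of \<open>Sigma_at v c\<close>; it is the whole space
  if no half-space with apex \<open>c\<close> contains the cone.\<close>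

definition apex_hull :: "('p \<Rightarrow> real^'n) \<Rightarrow> 'n tproj \<Rightarrow> (real^'n) set" where
  "apex_hull v c = {x. \<forall>b K. proj b = c \<longrightarrow> valid v b K \<longrightarrow> x \<in> rhalf b K}"

lemma proj_eq_iff: "proj x = proj y \<longleftrightarrow> (\<exists>t. \<forall>i. y $ i = t + x $ i)"
  by (simp add: tproj.abs_eq_iff shift_equiv_def)

lemma obtain_argmax:
  fixes f :: "'n::finite \<Rightarrow> 'b::linorder"
  obtains k where "\<And>l. f l \<le> f k"
proof -
  have "Max (range f) \<in> range f" by (intro Max_in) auto
  then obtain k where k: "f k = Max (range f)" by (metis imageE)
  have "f l \<le> f k" for l unfolding k by (intro Max_ge) auto
  with that show ?thesis by blast
qed

section \<open>Half-spaces and the cone described by types\<close>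

lemma ereal_diff_le_iff:
  fixes x y :: ereal and p q :: real
  shows "x - ereal p \<le> y - ereal q \<longleftrightarrow> x + ereal (q - p) \<le> y"
  by (cases x; cases y) auto

lemma in_halfspace_iff:
  fixes y :: "ereal^'n"
  assumes "K \<noteq> {}" "K \<noteq> UNIV"
  shows "y \<in> halfspace b K \<longleftrightarrow> y \<in> rmax_vecs - {bot_vec} \<and>
    (\<exists>i\<in>K. \<forall>l. y $ l + ereal (b $ i - b $ l) \<le> y $ i)"
proof -
  define f where "f = (\<lambda>i. y $ i - ereal (b $ i))"
  have ne: "-K \<noteq> {}" using assms by auto
  have "Max (f ` K) \<ge> Max (f ` (-K)) \<longleftrightarrow> (\<exists>i\<in>K. \<forall>l\<in>-K. f l \<le> f i)"
  proof
    assume L: "Max (f ` K) \<ge> Max (f ` (-K))"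
    have "Max (f ` K) \<in> f ` K" using assms by (intro Max_in) auto
    then obtain i where i: "i \<in> K" "f i = Max (f ` K)" by (metis imageE)
    have "f l \<le> f i" if "l \<in> -K" for l
    proof -
      have "f l \<le> Max (f ` (-K))" using that by (intro Max_ge) auto
      then show ?thesis using L i by simp
    qed
    then show "\<exists>i\<in>K. \<forall>l\<in>-K. f l \<le> f i" using i by blast
  next
    assume "\<exists>i\<in>K. \<forall>l\<in>-K. f l \<le> f i"
    then obtain i where i: "i \<in> K" "\<forall>l\<in>-K. f l \<le> f i" by blast
    have "Max (f ` (-K)) \<le> f i" using ne i by (subst Max_le_iff) auto
    also have "f i \<le> Max (f ` K)" using i by (intro Max_ge) auto
    finally show "Max (f ` K) \<ge> Max (f ` (-K))" .
  qed
  also have "\<dots> \<longleftrightarrow> (\<exists>i\<in>K. \<forall>l. f l \<le> f i)"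
  proof
    assume "\<exists>i\<in>K. \<forall>l\<in>-K. f l \<le> f i"
    then obtain i where i: "i \<in> K" "\<forall>l\<in>-K. f l \<le> f i" by blast
    \<comment> \<open>The given \<open>i\<close> beats only the complement; a maximizer over
      \<open>K\<close> beats \<open>K\<close> as well, and the complement through
      \<open>i\<close>.\<close>
    have "Max (f ` K) \<in> f ` K" using assms by (intro Max_in) auto
    then obtain k where k: "k \<in> K" "f k = Max (f ` K)" by auto
    have "f l \<le> f k" if "l \<in> K" for l using that k(2) by simp
    then show "\<exists>i\<in>K. \<forall>l. f l \<le> f i" using i k(1) by (metis ComplI order_trans)
  qed auto
  finally show ?thesis
    unfolding halfspace_def f_def by (auto simp: ereal_diff_le_iff)
qed

lemma emb_in_halfspace_iff:
  fixes x :: "real^'n"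
  assumes "K \<noteq> {}" "K \<noteq> UNIV"
  shows "emb x \<in> halfspace b K \<longleftrightarrow> x \<in> rhalf b K"
proof -
  have "emb x \<in> rmax_vecs - {bot_vec}"
    by (auto simp: rmax_vecs_def bot_vec_def emb_def vec_eq_iff)
  then show ?thesis
    unfolding in_halfspace_iff[OF assms] by (auto simp: rhalf_def emb_def algebra_simps)
qed

lemma emb_in_tcone_iff:
  fixes v :: "'p::finite \<Rightarrow> real^'n"
  shows "emb x \<in> tcone v \<longleftrightarrow> x \<in> rcone v"
proof
  assume "emb x \<in> tcone v"
  then obtain \<mu> where mu: "\<And>i. ereal (x $ i) = (MAX r. \<mu> r + ereal (v r $ i))"
    by (auto simp: tcone_def emb_def vec_eq_iff)
  show "x \<in> rcone v"
    unfolding rcone_def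
  proof (intro CollectI allI)
    fix l
    have "(MAX r. \<mu> r + ereal (v r $ l)) \<in> range (\<lambda>r. \<mu> r + ereal (v r $ l))"
      by (intro Max_in) auto
    then have "ereal (x $ l) \<in> range (\<lambda>r. \<mu> r + ereal (v r $ l))" by (simp only: mu)
    then obtain r where r: "ereal (x $ l) = \<mu> r + ereal (v r $ l)" by blast
    then obtain m where m: "\<mu> r = ereal m" by (cases "\<mu> r") auto
    have "m + v r $ i \<le> x $ i" for i
    proof -
      have "\<mu> r + ereal (v r $ i) \<le> ereal (x $ i)"
        by (subst mu) (intro Max_ge; simp)
      then show ?thesis using m by simp
    qed
    moreover have "x $ l = m + v r $ l" using r m by simp
    ultimately have "r \<in> type_set v l x" unfolding type_set_def by (auto simp: algebra_simps)
    then show "type_set v l x \<noteq> {}" by blast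
  qed
next
  assume x: "x \<in> rcone v"
  \<comment> \<open>The largest scalar keeping \<open>m r + v r\<close> below
    \<open>x\<close>.\<close>
  define m where "m r = (MIN i. x $ i - v r $ i)" for r
  have m_le: "m r \<le> x $ i - v r $ i" for r i unfolding m_def by (intro Min_le) auto
  have "ereal (x $ l) = (MAX r. ereal (m r) + ereal (v r $ l))" for l
  proof (rule Max_eqI[symmetric])
    obtain r where r: "r \<in> type_set v l x" using x by (auto simp: rcone_def)
    have "x $ l - v r $ l \<le> m r"
      using r unfolding m_def type_set_def by (subst Min_ge_iff) (auto simp: algebra_simps)
    with m_le[of r l] have "ereal (x $ l) = ereal (m r) + ereal (v r $ l)" by simp
    then show "ereal (x $ l) \<in> range (\<lambda>r. ereal (m r) + ereal (v r $ l))" by blast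
  qed (use m_le in \<open>auto simp: algebra_simps\<close>)
  then show "emb x \<in> tcone v"
    unfolding tcone_def emb_def by (intro CollectI exI[of _ "\<lambda>r. ereal (m r)"]) (auto simp: vec_eq_iff)
qed

text \<open>One finite coefficient already makes every coordinate finite, because the generators are
  real.\<close>

lemma tcone_real:
  fixes v :: "'p::finite \<Rightarrow> real^'n"
  assumes "y \<in> tcone v" "y \<noteq> bot_vec"
  obtains x where "y = emb x"
proof -
  obtain \<mu> where mu: "\<And>i. y $ i = (MAX r. \<mu> r + ereal (v r $ i))" "\<And>r. \<mu> r \<noteq> \<infinity>"
    using assms(1) by (auto simp: tcone_def)
  have "\<exists>r. \<mu> r \<noteq> -\<infinity>"
  proof (rule ccontr)
    assume "\<not> ?thesis"
    then have "y = bot_vec" by (auto simp: vec_eq_iff bot_vec_def mu(1))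
    then show False using assms(2) by simp
  qed
  then obtain r where r: "\<mu> r \<noteq> -\<infinity>" by blast
  have "\<bar>y $ i\<bar> \<noteq> \<infinity>" for i
  proof -
    have "\<mu> r + ereal (v r $ i) \<le> y $ i" unfolding mu by (intro Max_ge) auto
    then have "y $ i \<noteq> -\<infinity>" using r by (cases "\<mu> r") auto
    moreover have "y $ i \<in> range (\<lambda>r. \<mu> r + ereal (v r $ i))"
      unfolding mu by (intro Max_in) auto
    then have "y $ i \<noteq> \<infinity>" using mu(2) by auto
    ultimately show ?thesis by auto
  qed
  then have "y = emb (\<chi> i. real_of_ereal (y $ i))"
    by (auto simp: emb_def vec_eq_iff ereal_real)
  with that show ?thesis by blast
qed

lemma generator_in_rcone: "v r \<in> rcone v"
proof -
  have "r \<in> type_set v l (v r)" for l by (simp add: type_set_def)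
  then show ?thesis unfolding rcone_def by blast
qed

text \<open>At a maximizer \<open>k\<close> of \<open>x - b\<close>, take a generator attaining
  \<open>x\<close> there. It maximizes its difference to \<open>b\<close> at some \<open>i\<close>
  in \<open>K\<close>, and chaining the two inequalities makes \<open>i\<close> a maximizer of
  \<open>x - b\<close> too.\<close>

lemma rcone_subset_rhalf:
  fixes v :: "'p \<Rightarrow> real^'n"
  assumes "valid v b K"
  shows "rcone v \<subseteq> rhalf b K"
proof
  fix x assume x: "x \<in> rcone v"
  obtain k where k: "\<And>l. x $ l - b $ l \<le> x $ k - b $ k"
    using obtain_argmax[of "\<lambda>l. x $ l - b $ l"] by blast
  obtain r where r: "r \<in> type_set v k x" using x by (auto simp: rcone_def)
  obtain i where i: "i \<in> K" "r \<in> type_set v i b" using assms by (auto simp: valid_def)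
  have "v r $ i - x $ i \<le> v r $ k - x $ k" using r by (auto simp: type_set_def)
  moreover have "v r $ k - b $ k \<le> v r $ i - b $ i" using i by (auto simp: type_set_def)
  ultimately have "x $ k - b $ k \<le> x $ i - b $ i" by linarith
  then show "x \<in> rhalf b K" using k i(1) unfolding rhalf_def by (blast intro: order_trans)
qed

lemma valid_iff:
  fixes v :: "'p::finite \<Rightarrow> real^'n"
  shows "K \<noteq> {} \<and> K \<noteq> UNIV \<and> tcone v - {bot_vec} \<subseteq> halfspace b K \<longleftrightarrow> valid v b K"
proof (cases "K \<noteq> {} \<and> K \<noteq> UNIV")
  case True
  then have K: "K \<noteq> {}" "K \<noteq> UNIV" by auto
  have "tcone v - {bot_vec} \<subseteq> halfspace b K \<longleftrightarrow> rcone v \<subseteq> rhalf b K"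
  proof
    assume sub: "tcone v - {bot_vec} \<subseteq> halfspace b K"
    show "rcone v \<subseteq> rhalf b K"
    proof
      fix x assume "x \<in> rcone v"
      moreover have "emb x \<noteq> bot_vec" by (auto simp: emb_def bot_vec_def vec_eq_iff)
      ultimately have "emb x \<in> halfspace b K" using sub emb_in_tcone_iff[of x v] by auto
      then show "x \<in> rhalf b K" by (simp add: emb_in_halfspace_iff[OF K])
    qed
  next
    assume sub: "rcone v \<subseteq> rhalf b K"
    show "tcone v - {bot_vec} \<subseteq> halfspace b K"
    proof
      fix y assume y: "y \<in> tcone v - {bot_vec}"
      then obtain x where "y = emb x" using tcone_real by blast
      with y sub show "y \<in> halfspace b K"
        by (auto simp: emb_in_halfspace_iff[OF K] emb_in_tcone_iff)
    qed
  qed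
  also have "\<dots> \<longleftrightarrow> valid v b K"
  proof
    assume "rcone v \<subseteq> rhalf b K"
    then have "v r \<in> rhalf b K" for r using generator_in_rcone[of v r] by blast
    then show "valid v b K" using K by (auto simp: valid_def rhalf_def type_set_def)
  qed (rule rcone_subset_rhalf)
  finally show ?thesis using K by blast
qed (auto simp: valid_def)

lemma type_set_shift:
  assumes "\<And>i. y $ i = t + x $ i"
  shows "type_set v l y = type_set v l x"
  unfolding type_set_def assms by (auto simp: algebra_simps)

lemma proj_in_tcone_proj_iff:
  fixes v :: "'p::finite \<Rightarrow> real^'n"
  shows "proj b \<in> tcone_proj v \<longleftrightarrow> b \<in> rcone v"
proof -
  have "y \<in> rcone v" if x: "x \<in> rcone v" "proj x = proj y" for x y
  proof -
    obtain t where "\<And>i. y $ i = t + x $ i" using x(2) proj_eq_iff by blast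
    then show ?thesis using x(1) type_set_shift[of y t x v] by (auto simp: rcone_def)
  qed
  then show ?thesis unfolding tcone_proj_def emb_in_tcone_iff by (auto dest: sym)
qed

lemma Sigma_at_eq:
  "Sigma_at v c = {halfspace b K | b K. proj b = c \<and> valid v b K}"
  by (simp add: Sigma_at_def flip: valid_iff)

lemma Sigma_all_eq:
  "Sigma_all v = {halfspace b K | b K. valid v b K \<and> b \<in> rcone v}"
  by (simp add: Sigma_all_def proj_in_tcone_proj_iff conj_assoc flip: valid_iff)

lemma emb_in_Inter_Sigma_at:
  "emb x \<in> \<Inter>(Sigma_at v c) \<longleftrightarrow> x \<in> apex_hull v c"
proof -
  have "emb x \<in> halfspace b K \<longleftrightarrow> x \<in> rhalf b K" if "valid v b K" for b K
    using that by (intro emb_in_halfspace_iff) (auto simp: valid_def)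
  then show ?thesis unfolding Sigma_at_eq apex_hull_def by blast
qed

section \<open>From real points to all max-plus points\<close>

lemma add_axis_notin_rhalf:
  assumes "\<epsilon> > 0" "l \<notin> K"
  shows "b + axis l \<epsilon> \<notin> rhalf b K"
proof
  assume "b + axis l \<epsilon> \<in> rhalf b K"
  then obtain i where "i \<in> K" "\<forall>k. (b + axis l \<epsilon>) $ k - b $ k \<le> (b + axis l \<epsilon>) $ i - b $ i"
    unfolding rhalf_def by blast
  then have "i \<in> K" "(b + axis l \<epsilon>) $ l - b $ l \<le> (b + axis l \<epsilon>) $ i - b $ i" by blast+
  with assms show False by (auto simp: axis_def split: if_splits)
qed

text \<open>A point outside a half-space with apex \<open>b\<close> stays outside when it is moved along the
  tropical segment towards \<open>b\<close>; every inner point of this segment is real.\<close>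

lemma Inter_subset_halfspace:
  fixes v :: "'p::finite \<Rightarrow> real^'n"
  assumes \<Gamma>: "\<And>G. G \<in> \<Gamma> \<Longrightarrow> \<exists>b K. G = halfspace b K \<and> valid v b K"
    and b: "valid v b K" "b \<in> rcone v"
    and real: "\<And>x. emb x \<in> \<Inter>\<Gamma> \<Longrightarrow> x \<in> rhalf b K"
  shows "\<Inter>\<Gamma> \<subseteq> halfspace b K"
proof
  fix y assume y: "y \<in> \<Inter>\<Gamma>"
  have K: "K \<noteq> {}" "K \<noteq> UNIV" using b by (auto simp: valid_def)
  show "y \<in> halfspace b K"
  proof (cases "y \<in> rmax_vecs - {bot_vec}")
    case False
    \<comment> \<open>The empty family has everything as its intersection, so only then can
      \<open>y\<close> be no admissible max-plus point; but then \<open>real\<close> would put every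
      real point into \<open>rhalf b K\<close>.\<close>
    have "\<Gamma> = {}"
    proof (rule ccontr)
      assume "\<Gamma> \<noteq> {}"
      then obtain G where "G \<in> \<Gamma>" by blast
      then show False using \<Gamma>[of G] y False by (auto simp: halfspace_def)
    qed
    obtain l where l: "l \<notin> K" using K by blast
    show ?thesis using real[of "b + axis l 1"] add_axis_notin_rhalf[of 1 l K b] l \<open>\<Gamma> = {}\<close> by auto
  next
    case True
    obtain t where t: "\<And>l. y $ l - ereal (b $ l) \<le> y $ t - ereal (b $ t)"
      using obtain_argmax[of "\<lambda>l. y $ l - ereal (b $ l)"] by blast
    have "y $ t \<noteq> -\<infinity>"
    proof
      assume "y $ t = -\<infinity>"
      then have "y $ l = -\<infinity>" for l using t[of l] by (cases "y $ l") auto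
      then show False using True by (auto simp: bot_vec_def vec_eq_iff)
    qed
    then obtain s where s: "y $ t = ereal s" using True by (cases "y $ t") (auto simp: rmax_vecs_def)
    \<comment> \<open>One unit below the maximum of \<open>y - b\<close>: mixing in
      \<open>\<nu> + b\<close> makes \<open>z\<close> real without touching coordinates where
      \<open>y - b\<close> is maximal.\<close>
    define \<nu> where "\<nu> = s - b $ t - 1"
    define z where "z = (\<chi> i. real_of_ereal (max (y $ i) (ereal (\<nu> + b $ i))))"
    have z: "ereal (z $ i) = max (y $ i) (ereal (\<nu> + b $ i))" for i
      using True by (cases "y $ i") (auto simp: z_def rmax_vecs_def max_def)
    have "emb z \<in> G" if "G \<in> \<Gamma>" for G
    proof -
      from \<Gamma>[OF that] obtain c L where G: "G = halfspace c L" "valid v c L" by blast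
      then have L: "L \<noteq> {}" "L \<noteq> UNIV" by (auto simp: valid_def)
      have "y \<in> halfspace c L" using y that G by auto
      then obtain i where i: "i \<in> L" "\<And>l. y $ l + ereal (c $ i - c $ l) \<le> y $ i"
        unfolding in_halfspace_iff[OF L] by blast
      obtain k where k: "k \<in> L" "\<And>l. b $ l - c $ l \<le> b $ k - c $ k"
        using rcone_subset_rhalf[OF G(2)] b(2) by (auto simp: rhalf_def)
      \<comment> \<open>A coordinate of \<open>z\<close> stems either from \<open>\<nu> + b\<close>,
        controlled by \<open>k\<close>, or from \<open>y\<close>, controlled by
        \<open>i\<close>.\<close>
      have ub: "z $ l - c $ l \<le> max (z $ i - c $ i) (z $ k - c $ k)" for l
      proof (cases "y $ l \<le> ereal (\<nu> + b $ l)")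
        case True
        then have "z $ l = \<nu> + b $ l" using z[of l] by (simp add: max_def)
        moreover have "\<nu> + b $ k \<le> z $ k"
          using z[of k] by (metis ereal_less_eq(3) max.cobounded2)
        ultimately show ?thesis using k(2)[of l] by linarith
      next
        case False
        then have "ereal (z $ l) = y $ l" using z[of l] by (simp add: max_def)
        then have "ereal (z $ l + (c $ i - c $ l)) \<le> y $ i" using i(2)[of l] by (metis plus_ereal.simps(1))
        also have "\<dots> \<le> ereal (z $ i)" using z[of i] by simp
        finally show ?thesis by simp
      qed
      have "z \<in> rhalf c L"
      proof (cases "z $ i - c $ i \<le> z $ k - c $ k")
        case True
        then show ?thesis using ub k(1) unfolding rhalf_def by (force simp: max_def)
      next
        case False
        then show ?thesis using ub i(1) unfolding rhalf_def by (force simp: max_def)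
      qed
      then show ?thesis unfolding G(1) emb_in_halfspace_iff[OF L] .
    qed
    then have "z \<in> rhalf b K" by (intro real) auto
    then obtain i where i: "i \<in> K" "\<And>l. z $ l - b $ l \<le> z $ i - b $ i" by (auto simp: rhalf_def)
    \<comment> \<open>A maximizer \<open>i\<close> of \<open>z - b\<close> lies above the level
      \<open>\<nu>\<close>, so \<open>z\<close> and \<open>y\<close> agree there and
      \<open>i\<close> serves for \<open>y\<close> too.\<close>
    have "s \<le> z $ t" using z[of t] s by (metis ereal_less_eq(3) max.cobounded1)
    then have "z $ i > \<nu> + b $ i" using i(2)[of t] by (auto simp: \<nu>_def)
    then have yi: "y $ i = ereal (z $ i)"
      using z[of i] by (metis less_ereal.simps(1) max_def order_less_irrefl)
    have "y $ l + ereal (b $ i - b $ l) \<le> y $ i" for l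
    proof -
      have "y $ l \<le> ereal (z $ l)" using z[of l] by simp
      then have "y $ l + ereal (b $ i - b $ l) \<le> ereal (z $ l) + ereal (b $ i - b $ l)"
        by (rule add_right_mono)
      also have "\<dots> \<le> y $ i" using i(2)[of l] yi by simp
      finally show ?thesis .
    qed
    then show ?thesis unfolding in_halfspace_iff[OF K] using True i(1) by blast
  qed
qed

text \<open>Turns the condition in \<open>tau'\<close> into an inclusion of sets of real vectors.
  The apex is taken in the cone because \<open>Sigma_all\<close>, unlike \<open>Sigma_at\<close>,
  demands this.\<close>

lemma Sigma_at_subset_tau_iff:
  fixes v :: "'p::finite \<Rightarrow> real^'n"
  assumes "c \<in> tcone_proj v"
  shows "Sigma_at v c \<subseteq> tau v (\<Union>d\<in>X. Sigma_at v d) \<longleftrightarrow>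
    (\<Inter>d\<in>X. apex_hull v d) \<subseteq> apex_hull v c"
proof -
  have emb: "emb x \<in> \<Inter>(\<Union>d\<in>X. Sigma_at v d) \<longleftrightarrow> x \<in> (\<Inter>d\<in>X. apex_hull v d)" for x
    using emb_in_Inter_Sigma_at[of x v] by blast
  show ?thesis
  proof
    assume L: "Sigma_at v c \<subseteq> tau v (\<Union>d\<in>X. Sigma_at v d)"
    show "(\<Inter>d\<in>X. apex_hull v d) \<subseteq> apex_hull v c"
    proof
      fix x assume "x \<in> (\<Inter>d\<in>X. apex_hull v d)"
      then have "emb x \<in> \<Inter>(Sigma_at v c)" using L emb unfolding tau_def by blast
      then show "x \<in> apex_hull v c" by (simp only: emb_in_Inter_Sigma_at)
    qed
  next
    assume R: "(\<Inter>d\<in>X. apex_hull v d) \<subseteq> apex_hull v c"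
    show "Sigma_at v c \<subseteq> tau v (\<Union>d\<in>X. Sigma_at v d)"
    proof
      fix H assume "H \<in> Sigma_at v c"
      then obtain b K where H: "H = halfspace b K" "proj b = c" "valid v b K"
        unfolding Sigma_at_eq by blast
      have b: "b \<in> rcone v" using assms H(2) proj_in_tcone_proj_iff by blast
      have "\<Inter>(\<Union>d\<in>X. Sigma_at v d) \<subseteq> halfspace b K"
      proof (rule Inter_subset_halfspace[OF _ H(3) b])
        show "\<exists>b K. G = halfspace b K \<and> valid v b K" if "G \<in> (\<Union>d\<in>X. Sigma_at v d)" for G
          using that by (auto simp: Sigma_at_eq)
        show "x \<in> rhalf b K" if "emb x \<in> \<Inter>(\<Union>d\<in>X. Sigma_at v d)" for x
          using that R H unfolding emb apex_hull_def by blast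
      qed
      then show "H \<in> tau v (\<Union>d\<in>X. Sigma_at v d)"
        unfolding tau_def Sigma_all_eq using H b by blast
    qed
  qed
qed


section \<open>The boundary of the cone\<close>

lemma closed_rcone:
  fixes v :: "'p::finite \<Rightarrow> real^'n"
  shows "closed (rcone v)"
proof -
  have "rcone v = (\<Inter>l. \<Union>r. \<Inter>i. {x. v r $ i - x $ i \<le> v r $ l - x $ l})"
    by (auto simp: rcone_def type_set_def)
  moreover have "closed {x. v r $ i - x $ i \<le> v r $ l - x $ l}" for r i l
    by (intro closed_Collect_le continuous_intros)
  ultimately show ?thesis by (auto intro!: closed_INT closed_UN)
qed

lemma frontier_tcone_proj_subset:
  fixes v :: "'p::finite \<Rightarrow> real^'n"
  shows "frontier (tcone_proj v) \<subseteq> tcone_proj v"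
proof -
  have "proj -` (- tcone_proj v) = - rcone v" by (auto simp: proj_in_tcone_proj_iff)
  then have "closed (tcone_proj v)"
    unfolding closed_def open_tproj_def using closed_rcone[of v] by (simp add: open_Compl)
  then show ?thesis by (simp add: frontier_def closure_closed)
qed

text \<open>Raising a coordinate outside \<open>K\<close> by any positive amount leaves the
  half-space, hence the cone, so the apex is not interior.\<close>

lemma apex_in_frontier:
  fixes v :: "'p::finite \<Rightarrow> real^'n"
  assumes "b \<in> rcone v" "valid v b K"
  shows "proj b \<in> frontier (tcone_proj v)"
proof -
  have "proj b \<notin> interior (tcone_proj v)"
  proof
    assume "proj b \<in> interior (tcone_proj v)"
    then obtain U where U: "open U" "proj b \<in> U" "U \<subseteq> tcone_proj v" by (auto simp: interior_def)
    then have "open (proj -` U)" "b \<in> proj -` U" by (auto simp: open_tproj_def)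
    then obtain e where e: "e > 0" "ball b e \<subseteq> proj -` U" by (meson openE)
    obtain l where l: "l \<notin> K" using assms(2) by (auto simp: valid_def)
    have "norm (axis l (e/2) :: real^'n) = e/2"
      using e(1) by (simp add: norm_eq_sqrt_inner inner_axis_axis power2_eq_square[symmetric])
    then have "b + axis l (e/2) \<in> ball b e" using e(1) by (simp add: dist_norm)
    then have "b + axis l (e/2) \<in> rcone v"
      using e U proj_in_tcone_proj_iff[of "b + axis l (e/2)" v] by blast
    then show False
      using rcone_subset_rhalf[OF assms(2)] add_axis_notin_rhalf[of "e/2" l K b] e l by auto
  qed
  moreover have "proj b \<in> closure (tcone_proj v)"
    using assms(1) closure_subset[of "tcone_proj v"] by (auto simp: proj_in_tcone_proj_iff[symmetric])
  ultimately show ?thesis by (simp add: frontier_def)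
qed

definition generating :: "'a set \<Rightarrow> ('a \<Rightarrow> 'b set) \<Rightarrow> 'a set \<Rightarrow> bool" where
  "generating F f X \<longleftrightarrow> finite X \<and> X \<subseteq> F \<and> (\<forall>b\<in>F. (\<Inter>c\<in>X. f c) \<subseteq> f b)"

lemma apex_generating_iff:
  fixes v :: "'p::finite \<Rightarrow> real^'n"
  shows "apex_generating v X \<longleftrightarrow> generating (frontier (tcone_proj v)) (apex_hull v) X"
proof -
  have "b \<in> tau' v X \<longleftrightarrow> (\<Inter>c\<in>X. apex_hull v c) \<subseteq> apex_hull v b"
    if "b \<in> frontier (tcone_proj v)" for b
  proof -
    have "b \<in> tcone_proj v" using that frontier_tcone_proj_subset by blast
    then show ?thesis using that by (simp only: tau'_def mem_Collect_eq Sigma_at_subset_tau_iff simp_thms)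
  qed
  moreover have "tau' v X \<subseteq> frontier (tcone_proj v)" by (auto simp: tau'_def)
  ultimately show ?thesis unfolding apex_generating_def generating_def by blast
qed


section \<open>Uniqueness of the minimal generating set\<close>

text \<open>If \<open>b\<close> is in \<open>X\<close> but not in \<open>Y\<close>, enlarge
  \<open>X - {b}\<close> by as many elements of \<open>Y\<close> as possible without implying
  \<open>b\<close>. One more element \<open>c\<close> of \<open>Y\<close> then implies
  \<open>b\<close>, while adding \<open>b\<close> instead implies \<open>c\<close>; anti-exchange
  makes \<open>b\<close> already implied, a contradiction.\<close>

lemma minimal_generating_subset:
  assumes anti_exchange: "\<And>Y b c. Y \<subseteq> F \<Longrightarrow> b \<in> F \<Longrightarrow> c \<in> F \<Longrightarrow> b \<noteq> c \<Longrightarrow>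
      (\<Inter>d\<in>Y. f d) \<inter> f b = (\<Inter>d\<in>Y. f d) \<inter> f c \<Longrightarrow> (\<Inter>d\<in>Y. f d) \<subseteq> f b"
    and X: "generating F f X" "\<And>Z. generating F f Z \<Longrightarrow> Z \<subseteq> X \<Longrightarrow> Z = X"
    and Y: "generating F f Y"
  shows "X \<subseteq> Y"
proof
  fix b assume b: "b \<in> X"
  show "b \<in> Y"
  proof (rule ccontr)
    assume "b \<notin> Y"
    define good where "good Z \<longleftrightarrow> Z \<subseteq> Y \<and> \<not> (\<Inter>d\<in>(X - {b}) \<union> Z. f d) \<subseteq> f b" for Z
    have F: "X \<subseteq> F" "Y \<subseteq> F" "finite Y" "b \<in> F" using X(1) Y b by (auto simp: generating_def)
    have "good {}"
    proof (rule ccontr)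
      assume "\<not> good {}"
      then have "(\<Inter>d\<in>X - {b}. f d) \<subseteq> (\<Inter>d\<in>X. f d)" unfolding good_def by auto
      then have "generating F f (X - {b})" using X(1) unfolding generating_def by blast
      then show False using X(2)[of "X - {b}"] b by blast
    qed
    moreover have "card Z < Suc (card Y)" if "good Z" for Z
      using that F(3) by (auto simp: good_def less_Suc_eq_le intro: card_mono)
    ultimately obtain Z where Z: "good Z" "\<And>Z'. good Z' \<Longrightarrow> card Z' \<le> card Z"
      using ex_has_greatest_nat[of good "{}" card "Suc (card Y)"] by auto
    have "Z \<noteq> Y"
    proof
      assume "Z = Y"
      then have "(\<Inter>d\<in>(X - {b}) \<union> Z. f d) \<subseteq> (\<Inter>d\<in>Y. f d)" by blast
      also have "\<dots> \<subseteq> f b" using Y F by (auto simp: generating_def)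
      finally show False using Z(1) by (simp add: good_def)
    qed
    then obtain c where c: "c \<in> Y" "c \<notin> Z" using Z(1) by (auto simp: good_def)
    define W where "W = (X - {b}) \<union> Z"
    have "\<not> good (insert c Z)"
    proof
      assume "good (insert c Z)"
      then have "card (insert c Z) \<le> card Z" by (rule Z(2))
      moreover have "finite Z" using Z(1) F(3) finite_subset by (auto simp: good_def)
      ultimately show False using c by simp
    qed
    then have 1: "(\<Inter>d\<in>W. f d) \<inter> f c \<subseteq> f b"
      using c Z(1) unfolding good_def W_def by auto
    have "(\<Inter>d\<in>W. f d) \<inter> f b \<subseteq> (\<Inter>d\<in>X. f d)" unfolding W_def by blast
    also have "\<dots> \<subseteq> f c" using X(1) c F by (auto simp: generating_def)
    finally have "(\<Inter>d\<in>W. f d) \<inter> f b = (\<Inter>d\<in>W. f d) \<inter> f c" using 1 by blast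
    then have "(\<Inter>d\<in>W. f d) \<subseteq> f b"
      using F c Z(1) \<open>b \<notin> Y\<close> by (intro anti_exchange[of W b c]) (auto simp: W_def good_def)
    then show False using Z(1) by (simp add: good_def W_def)
  qed
qed

section \<open>Tropical convexity and the anti-exchange property\<close>

definition tconvex :: "(real^'n) set \<Rightarrow> bool" where
  "tconvex S \<longleftrightarrow> (\<forall>x\<in>S. \<forall>y\<in>S. \<forall>s t. (\<chi> i. max (s + x $ i) (t + y $ i)) \<in> S)"

lemma tconvexD:
  assumes "tconvex S" "x \<in> S" "y \<in> S"
  shows "(\<chi> i. max (s + x $ i) (t + y $ i)) \<in> S"
  using assms by (simp add: tconvex_def)

lemma tconvex_Int: "tconvex S \<Longrightarrow> tconvex T \<Longrightarrow> tconvex (S \<inter> T)"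
  by (simp add: tconvex_def)

lemma tconvex_INT: "(\<And>d. d \<in> Y \<Longrightarrow> tconvex (S d)) \<Longrightarrow> tconvex (\<Inter>d\<in>Y. S d)"
  by (simp add: tconvex_def)

lemma tconvex_rhalf:
  fixes b :: "real^'n"
  shows "tconvex (rhalf b K)"
  unfolding tconvex_def
proof (intro ballI allI)
  fix x y :: "real^'n" and s t
  assume "x \<in> rhalf b K" "y \<in> rhalf b K"
  then obtain i k where i: "i \<in> K" "\<And>l. x $ l - b $ l \<le> x $ i - b $ i"
    and k: "k \<in> K" "\<And>l. y $ l - b $ l \<le> y $ k - b $ k" by (auto simp: rhalf_def)
  let ?z = "\<chi> i. max (s + x $ i) (t + y $ i)"
  have ub: "?z $ l - b $ l \<le> max (s + (x $ i - b $ i)) (t + (y $ k - b $ k))" for l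
    using i(2)[of l] k(2)[of l] by (auto simp: max_def)
  have "s + (x $ i - b $ i) \<le> ?z $ i - b $ i" "t + (y $ k - b $ k) \<le> ?z $ k - b $ k"
    by (auto simp: max_def)
  with ub have "(\<forall>l. ?z $ l - b $ l \<le> ?z $ i - b $ i) \<or> (\<forall>l. ?z $ l - b $ l \<le> ?z $ k - b $ k)"
    by (smt (verit))
  then show "?z \<in> rhalf b K" using i(1) k(1) unfolding rhalf_def by blast
qed

lemma tconvex_apex_hull: "tconvex (apex_hull v c)"
  using tconvex_rhalf unfolding tconvex_def apex_hull_def by blast

lemma rcone_subset_apex_hull: "rcone v \<subseteq> apex_hull v c"
  using rcone_subset_rhalf unfolding apex_hull_def by blast

text \<open>Up to a shift of the representative, adding \<open>s + b\<close> only raises the entries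
  of \<open>z - b\<close> to a level strictly below their maximum, so a maximizer in
  \<open>K\<close> after the move was one before.\<close>

lemma move_towards_apex:
  assumes "z \<notin> apex_hull v (proj b)" "s < z $ l - b $ l"
  shows "(\<chi> i. max (z $ i) (s + b $ i)) \<notin> apex_hull v (proj b)"
proof -
  obtain b' K where b': "proj b' = proj b" "valid v b' K" "z \<notin> rhalf b' K"
    using assms(1) by (auto simp: apex_hull_def)
  obtain t where t: "\<And>i. b $ i = t + b' $ i" using b'(1) proj_eq_iff by blast
  have "(\<chi> i. max (z $ i) (s + b $ i)) \<notin> rhalf b' K"
  proof
    assume "(\<chi> i. max (z $ i) (s + b $ i)) \<in> rhalf b' K"
    then obtain i where i: "i \<in> K"
      "\<And>l. max (z $ l) (s + b $ l) - b' $ l \<le> max (z $ i) (s + b $ i) - b' $ i"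
      by (auto simp: rhalf_def)
    have "z $ l - b' $ l \<le> max (z $ i) (s + b $ i) - b' $ i"
      using i(2)[of l] by linarith
    then have "s + b $ i < z $ i" using assms(2) t[of l] t[of i] by (auto simp: max_def split: if_splits)
    then have "\<forall>l. z $ l - b' $ l \<le> z $ i - b' $ i" using i(2) by (smt (verit))
    then show False using b'(3) i(1) by (auto simp: rhalf_def)
  qed
  then show ?thesis using b' by (auto simp: apex_hull_def)
qed

text \<open>Starting from \<open>y \<in> P - Q\<close>, steps towards \<open>b\<close> and \<open>c\<close> stay outside \<open>Q\<close>. They are chosen so that
  \<open>y\<close> itself gets absorbed, and the end point is a tropical combination of \<open>b\<close> and \<open>c\<close>, hence in \<open>Q\<close>.\<close>

lemma anti_exchange_aux:
  fixes b c :: "real^'n"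
  assumes Q: "tconvex Q" "b \<in> Q" "c \<in> Q"
    and ne: "proj b \<noteq> proj c"
    and push_b: "\<And>z s l. z \<in> P - Q \<Longrightarrow> s < z $ l - b $ l \<Longrightarrow> (\<chi> i. max (z $ i) (s + b $ i)) \<in> P - Q"
    and push_c: "\<And>z s l. z \<in> P - Q \<Longrightarrow> s < z $ l - c $ l \<Longrightarrow> (\<chi> i. max (z $ i) (s + c $ i)) \<in> P - Q"
  shows "P \<subseteq> Q"
proof (rule ccontr)
  assume "\<not> P \<subseteq> Q"
  then obtain y where y: "y \<in> P - Q" by blast
  obtain t0 where t0: "\<And>l. y $ l - b $ l \<le> y $ t0 - b $ t0"
    using obtain_argmax[of "\<lambda>l. y $ l - b $ l"] by blast
  obtain k where k: "\<And>l. b $ l - c $ l \<le> b $ k - c $ k"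
    using obtain_argmax[of "\<lambda>l. b $ l - c $ l"] by blast
  define m where "m = y $ t0 - b $ t0"
  define \<mu> where "\<mu> = b $ k - c $ k"
  have comb: "(\<chi> i. max (s + b $ i) (t + c $ i)) \<in> Q" for s t
    using Q by (rule tconvexD)
  \<comment> \<open>The order of the two moves depends on whether some index maximizes
    \<open>y - b\<close> and \<open>b - c\<close> simultaneously.\<close>
  show False
  proof (cases "\<exists>t. y $ t - b $ t = m \<and> b $ t - c $ t = \<mu>")
    case True
    then obtain t where t: "y $ t - b $ t = m" "b $ t - c $ t = \<mu>" by blast
    obtain l where l: "b $ l - c $ l < \<mu>"
    proof -
      have "\<exists>l. b $ l - c $ l \<noteq> \<mu>"
      proof (rule ccontr)
        assume "\<not> ?thesis"
        then have "\<forall>i. c $ i = - \<mu> + b $ i" by (auto simp: algebra_simps)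
        then show False using ne proj_eq_iff by blast
      qed
      then show ?thesis using that k unfolding \<mu>_def by (metis order_le_less)
    qed
    \<comment> \<open>The first move, towards \<open>c\<close>, is allowed at \<open>t\<close> and
      lifts coordinate \<open>l\<close> to \<open>m + \<delta>\<close> above \<open>b\<close>; this
      permits moving to the full level \<open>m\<close>, where \<open>m + b\<close> dominates
      \<open>y\<close>.\<close>
    define \<delta> where "\<delta> = (\<mu> - (b $ l - c $ l)) / 2"
    have \<delta>: "\<delta> > 0" "2 * \<delta> = \<mu> - (b $ l - c $ l)" using l by (auto simp: \<delta>_def)
    define z where "z = (\<chi> i. max (y $ i) (m + \<mu> - \<delta> + c $ i))"
    have z: "z \<in> P - Q" unfolding z_def by (rule push_c[OF y, of _ t]) (use t \<delta> in auto)
    have "m < z $ l - b $ l" using \<delta> by (auto simp: z_def)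
    then have "(\<chi> i. max (z $ i) (m + b $ i)) \<in> P - Q" by (rule push_b[OF z])
    moreover have "(\<chi> i. max (z $ i) (m + b $ i)) = (\<chi> i. max (m + b $ i) (m + \<mu> - \<delta> + c $ i))"
    proof -
      have "max (max (y $ i) s) (m + b $ i) = max (m + b $ i) s" for i s
        using t0[of i] by (auto simp: m_def max_def)
      then show ?thesis by (simp add: z_def vec_eq_iff)
    qed
    ultimately show False using comb by simp
  next
    case False
    \<comment> \<open>With \<open>\<epsilon>\<close> below every \<open>g t\<close>, coordinates
      where \<open>y - b\<close> is not maximal are absorbed by \<open>m - \<epsilon> + b\<close>;
      at the others \<open>b - c\<close> is below \<open>\<mu>\<close>, and the move towards
      \<open>c\<close> absorbs them.\<close>
    define g where "g t = (if y $ t - b $ t < m then m - (y $ t - b $ t) else (\<mu> - (b $ t - c $ t)) / 2)"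
      for t
    define \<epsilon> where "\<epsilon> = Min (range g)"
    have "g t > 0" for t
    proof (cases "y $ t - b $ t < m")
      case lt: False
      then have "y $ t - b $ t = m" using t0[of t] by (simp add: m_def)
      then have "b $ t - c $ t \<noteq> \<mu>" using False by blast
      then show ?thesis using k[of t] lt by (simp add: g_def \<mu>_def)
    qed (simp add: g_def)
    then have \<epsilon>: "\<epsilon> > 0" by (simp add: \<epsilon>_def)
    have \<epsilon>_le: "\<epsilon> \<le> g t" for t unfolding \<epsilon>_def by (intro Min_le) auto
    define z where "z = (\<chi> i. max (y $ i) (m - \<epsilon> + b $ i))"
    have z: "z \<in> P - Q" unfolding z_def by (rule push_b[OF y, of _ t0]) (use \<epsilon> in \<open>auto simp: m_def\<close>)
    have "m + \<mu> - 2 * \<epsilon> < z $ k - c $ k" using \<epsilon> by (auto simp: z_def \<mu>_def)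
    then have "(\<chi> i. max (z $ i) (m + \<mu> - 2 * \<epsilon> + c $ i)) \<in> P - Q" by (rule push_c[OF z])
    moreover have "(\<chi> i. max (z $ i) (m + \<mu> - 2 * \<epsilon> + c $ i)) =
        (\<chi> i. max (m - \<epsilon> + b $ i) (m + \<mu> - 2 * \<epsilon> + c $ i))"
    proof -
      have "y $ i \<le> max (m - \<epsilon> + b $ i) (m + \<mu> - 2 * \<epsilon> + c $ i)" for i
        using \<epsilon>_le[of i] t0[of i] by (auto simp: g_def m_def split: if_splits)
      then show ?thesis by (simp add: z_def vec_eq_iff max.assoc max.absorb2)
    qed
    ultimately show False using comb by simp
  qed
qed

lemma apex_hull_anti_exchange:
  fixes v :: "'p::finite \<Rightarrow> real^'n"
  assumes "b \<in> tcone_proj v" "c \<in> tcone_proj v" "b \<noteq> c"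
    and eq: "(\<Inter>d\<in>Y. apex_hull v d) \<inter> apex_hull v b = (\<Inter>d\<in>Y. apex_hull v d) \<inter> apex_hull v c"
  shows "(\<Inter>d\<in>Y. apex_hull v d) \<subseteq> apex_hull v b"
proof -
  define P where "P = (\<Inter>d\<in>Y. apex_hull v d)"
  define Q where "Q = P \<inter> apex_hull v b"
  \<comment> \<open>Thus a point of \<open>P\<close> outside \<open>Q\<close> lies outside the hulls
    of both apices, so it can be pushed towards either.\<close>
  have Q': "Q = P \<inter> apex_hull v c" using eq by (simp add: P_def Q_def)
  obtain b' c' where b': "b = proj b'" "b' \<in> rcone v" and c': "c = proj c'" "c' \<in> rcone v"
    using assms(1,2) by (auto simp: tcone_proj_def emb_in_tcone_iff)
  have sub: "rcone v \<subseteq> P" "rcone v \<subseteq> Q"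
    using rcone_subset_apex_hull[of v] by (auto simp: P_def Q_def)
  have P: "tconvex P" unfolding P_def by (intro tconvex_INT tconvex_apex_hull)
  then have Q: "tconvex Q" unfolding Q_def by (intro tconvex_Int tconvex_apex_hull)
  have inP: "(\<chi> i. max (z $ i) (s + x $ i)) \<in> P" if "z \<in> P" "x \<in> rcone v" for z s x
  proof -
    have "x \<in> P" using that(2) sub by blast
    then show ?thesis using tconvexD[OF P that(1), of x 0 s] by simp
  qed
  have "P \<subseteq> Q"
  proof (rule anti_exchange_aux[OF Q, of b' c'])
    show "b' \<in> Q" "c' \<in> Q" "proj b' \<noteq> proj c'" using b' c' sub assms(3) by auto
    show "(\<chi> i. max (z $ i) (s + b' $ i)) \<in> P - Q" if "z \<in> P - Q" "s < z $ l - b' $ l" for z s l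
      using that inP[of z b' s] move_towards_apex[of z v b' s l] b' by (auto simp: Q_def)
    show "(\<chi> i. max (z $ i) (s + c' $ i)) \<in> P - Q" if "z \<in> P - Q" "s < z $ l - c' $ l" for z s l
      using that inP[of z c' s] move_towards_apex[of z v c' s l] c' by (auto simp: Q')
  qed
  then show ?thesis by (auto simp: P_def Q_def)
qed


section \<open>Existence of a finite generating set\<close>

text \<open>Take \<open>b\<close> as the projection of \<open>y\<close>, the largest cone point
  below it, and \<open>K\<close> as the coordinates where both agree. Every scaled generator touches
  \<open>y\<close> in \<open>K\<close>, whereas \<open>y - b\<close> is zero on \<open>K\<close> and
  positive elsewhere.\<close>

lemma separating_halfspace:
  fixes v :: "'p::finite \<Rightarrow> real^'n"
  assumes "y \<notin> rcone v"
  obtains b K where "b \<in> rcone v" "valid v b K" "y \<notin> rhalf b K"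
proof -
  define m where "m r = (MIN i. y $ i - v r $ i)" for r
  define b where "b = (\<chi> i. MAX r. m r + v r $ i)"
  have m_le: "m r + v r $ i \<le> y $ i" for r i
  proof -
    have "m r \<le> y $ i - v r $ i" unfolding m_def by (intro Min_le) auto
    then show ?thesis by simp
  qed
  have m_att: "\<exists>i. m r + v r $ i = y $ i" for r
  proof -
    have "m r \<in> range (\<lambda>i. y $ i - v r $ i)" unfolding m_def by (intro Min_in) auto
    then show ?thesis by (auto simp: algebra_simps)
  qed
  have b_ge: "m r + v r $ i \<le> b $ i" for r i unfolding b_def by (auto intro: Max_ge)
  have b_att: "\<exists>r. b $ i = m r + v r $ i" for i
  proof -
    have "b $ i \<in> range (\<lambda>r. m r + v r $ i)" unfolding b_def by (auto intro!: Max_in)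
    then show ?thesis by auto
  qed
  have type: "r \<in> type_set v i b" if "b $ i = m r + v r $ i" for r i
    unfolding type_set_def
  proof (intro CollectI allI)
    show "v r $ k - b $ k \<le> v r $ i - b $ i" for k using b_ge[of r k] that by linarith
  qed
  have b_le: "b $ i \<le> y $ i" for i using b_att[of i] m_le by metis
  have b: "b \<in> rcone v" using b_att type unfolding rcone_def by blast
  define K where "K = {i. b $ i = y $ i}"
  have in_K: "\<exists>i\<in>K. r \<in> type_set v i b" for r
  proof -
    obtain i where i: "m r + v r $ i = y $ i" using m_att by blast
    then have "b $ i = y $ i" using b_ge[of r i] b_le[of i] by simp
    then show ?thesis using type[of i r] i by (auto simp: K_def)
  qed
  have "K \<noteq> UNIV"
  proof
    assume "K = UNIV"
    then have "b = y" by (auto simp: K_def vec_eq_iff)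
    then show False using b assms by simp
  qed
  then obtain l where l: "l \<notin> K" by blast
  have "valid v b K" using in_K \<open>K \<noteq> UNIV\<close> unfolding valid_def by blast
  moreover have "y \<notin> rhalf b K"
  proof
    assume "y \<in> rhalf b K"
    then obtain i where "i \<in> K" "y $ l - b $ l \<le> y $ i - b $ i" by (auto simp: rhalf_def)
    then show False using l b_le[of l] by (auto simp: K_def)
  qed
  ultimately show ?thesis using that b by blast
qed

text \<open>Connectedness, phrased by cuts, of the graph on the coordinates with an edge between \<open>i\<close> and
  \<open>k\<close> whenever \<open>S\<^sub>i(b) \<inter> S\<^sub>k(b) \<noteq> \<emptyset>\<close>. Along edges, differences of the coordinates of \<open>b\<close> are
  differences of coordinates of generators, so there are finitely many such \<open>b\<close> modulo constants.\<close>

definition tie_connected :: "('p \<Rightarrow> real^'n) \<Rightarrow> real^'n \<Rightarrow> bool" where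
  "tie_connected v b \<longleftrightarrow>
     (\<forall>W. W \<noteq> {} \<longrightarrow> W \<noteq> UNIV \<longrightarrow> (\<exists>i\<in>W. \<exists>k\<in>-W. type_set v i b \<inter> type_set v k b \<noteq> {}))"

text \<open>A common tie prescribes the same coordinate difference in both points, so no tie can
  leave a level set of \<open>b' - b\<close>.\<close>

lemma tie_connected_determined:
  assumes "tie_connected v b" and same: "\<And>l. type_set v l b = type_set v l b'"
  shows "proj b = proj b'"
proof -
  fix i0
  define W where "W = {i. b' $ i - b $ i = b' $ i0 - b $ i0}"
  have "W = UNIV"
  proof (rule ccontr)
    assume "W \<noteq> UNIV"
    moreover have "i0 \<in> W" by (simp add: W_def)
    ultimately obtain i k r where ik: "i \<in> W" "k \<notin> W"
      and "r \<in> type_set v i b" "r \<in> type_set v k b"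
      using assms(1) unfolding tie_connected_def by (metis ComplD Int_emptyI empty_iff)
    moreover from this have "r \<in> type_set v i b'" "r \<in> type_set v k b'" using same by auto
    ultimately have "v r $ i - b $ i = v r $ k - b $ k" "v r $ i - b' $ i = v r $ k - b' $ k"
      by (auto simp: type_set_def intro!: antisym)
    then show False using ik by (auto simp: W_def)
  qed
  then have "b' $ i = (b' $ i0 - b $ i0) + b $ i" for i
    unfolding W_def by (simp add: set_eq_iff algebra_simps)
  then show ?thesis unfolding proj_eq_iff by blast
qed

text \<open>The class is a function of the type, and there are finitely many types.\<close>

lemma finite_tie_connected:
  fixes v :: "'p::finite \<Rightarrow> real^'n"
  shows "finite {proj b | b. tie_connected v b}"
proof -
  let ?S = "{b. tie_connected v b}"
  let ?T = "\<lambda>b l. type_set v l b"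
  define h where "h = (\<lambda>t. proj (SOME b. b \<in> ?S \<and> ?T b = t))"
  have "proj b = h (?T b)" if "b \<in> ?S" for b
  proof -
    have "(SOME b'. b' \<in> ?S \<and> ?T b' = ?T b) \<in> ?S \<and> ?T (SOME b'. b' \<in> ?S \<and> ?T b' = ?T b) = ?T b"
      by (rule someI[of _ b]) (use that in auto)
    then show ?thesis unfolding h_def
      using that tie_connected_determined[of v b "SOME b'. b' \<in> ?S \<and> ?T b' = ?T b"]
      by (auto simp: fun_eq_iff)
  qed
  then have "{proj b | b. tie_connected v b} \<subseteq> range h" by blast
  then show ?thesis by (rule finite_subset) simp
qed

text \<open>If no tie joins \<open>W\<close> to its complement, raising the coordinates of \<open>b\<close> in \<open>W\<close> up to the
  first new tie preserves all old ones.\<close>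

lemma raise_coordinates:
  fixes v :: "'p::finite \<Rightarrow> real^'n"
  assumes b: "b \<in> rcone v" and W: "W \<noteq> {}" "W \<noteq> UNIV"
    and sep: "\<And>i k. i \<in> W \<Longrightarrow> k \<notin> W \<Longrightarrow> type_set v i b \<inter> type_set v k b = {}"
  obtains b' where "\<And>i. i \<notin> W \<Longrightarrow> b' $ i = b $ i" "\<And>i. i \<in> W \<Longrightarrow> b $ i \<le> b' $ i"
    "\<And>l. type_set v l b \<subseteq> type_set v l b'"
    "\<exists>l. type_set v l b \<noteq> type_set v l b'"
proof -
  \<comment> \<open>Raising \<open>W\<close> endangers only comparisons of an active index inside
    \<open>W\<close> with one outside; \<open>g\<close> is their slack, and the least slack is the
    height of the first new tie.\<close>
  define D where "D = {(r, i, k). i \<in> W \<and> k \<notin> W \<and> r \<in> type_set v i b}"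
  define g where "g = (\<lambda>(r, i, k). (v r $ i - b $ i) - (v r $ k - b $ k))"
  have gpos: "g d > 0" if "d \<in> D" for d
  proof -
    obtain r i k where d: "d = (r, i, k)" by (cases d)
    with that have ik: "i \<in> W" "k \<notin> W" "r \<in> type_set v i b" by (auto simp: D_def)
    then have "r \<notin> type_set v k b" using sep by blast
    then obtain l where "v r $ k - b $ k < v r $ l - b $ l" by (auto simp: type_set_def not_le)
    moreover have "v r $ l - b $ l \<le> v r $ i - b $ i" using ik by (auto simp: type_set_def)
    ultimately show ?thesis by (simp add: d g_def)
  qed
  obtain i k where ik: "i \<in> W" "k \<notin> W" using W by blast
  moreover obtain r where "r \<in> type_set v i b" using b by (auto simp: rcone_def)
  ultimately have Dne: "D \<noteq> {}" by (auto simp: D_def)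
  define t where "t = Min (g ` D)"
  have fin: "finite (g ` D)" "g ` D \<noteq> {}" using Dne by auto
  have "t \<in> g ` D" unfolding t_def by (rule Min_in[OF fin])
  then obtain r0 i0 k0 where d0: "(r0, i0, k0) \<in> D" "t = g (r0, i0, k0)" by force
  have tpos: "t > 0" using gpos d0 by simp
  have t_le: "t \<le> g d" if "d \<in> D" for d unfolding t_def using that fin by (intro Min_le) auto
  define b' where "b' = (\<chi> i. if i \<in> W then b $ i + t else b $ i)"
  have sub: "type_set v l b \<subseteq> type_set v l b'" for l
  proof
    fix r assume r: "r \<in> type_set v l b"
    have "v r $ i - b' $ i \<le> v r $ l - b' $ l" for i
    proof (cases "l \<in> W \<and> i \<notin> W")
      case True
      then have "(r, l, i) \<in> D" using r by (auto simp: D_def)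
      then have "t \<le> (v r $ l - b $ l) - (v r $ i - b $ i)" using t_le by (force simp: g_def)
      then show ?thesis using True by (simp add: b'_def)
    next
      case False
      moreover have "v r $ i - b $ i \<le> v r $ l - b $ l" using r by (auto simp: type_set_def)
      ultimately show ?thesis using tpos by (auto simp: b'_def)
    qed
    then show "r \<in> type_set v l b'" by (auto simp: type_set_def)
  qed
  have "r0 \<in> type_set v i0 b'" using sub d0 by (auto simp: D_def)
  moreover have "v r0 $ i0 - b' $ i0 = v r0 $ k0 - b' $ k0" using d0 by (auto simp: D_def g_def b'_def)
  ultimately have "r0 \<in> type_set v k0 b'" by (simp add: type_set_def)
  moreover have "r0 \<notin> type_set v k0 b" using d0 sep by (auto simp: D_def)
  ultimately have "type_set v k0 b \<noteq> type_set v k0 b'" by blast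
  then show ?thesis using that[of b'] sub tpos by (auto simp: b'_def)
qed

text \<open>Raising a block of coordinates keeps \<open>y\<close> outside the half-space as long as the maximum of
  \<open>y - b\<close> is attained outside the block; so of a block and its complement one can be raised.\<close>

lemma separating_tie_connected:
  fixes v :: "'p::finite \<Rightarrow> real^'n"
  assumes "y \<notin> rcone v"
  obtains b K where "b \<in> rcone v" "valid v b K" "y \<notin> rhalf b K" "tie_connected v b"
proof -
  define good where "good b \<longleftrightarrow> b \<in> rcone v \<and> (\<exists>K. valid v b K \<and> y \<notin> rhalf b K)" for b
  \<comment> \<open>Counts all incidences in the type. It is bounded, so a separating apex
    maximizing it exists, and raising a block would increase it strictly.\<close>
  define N where "N b = (\<Sum>l\<in>UNIV. card (type_set v l b))" for b
  obtain b0 where "good b0" using separating_halfspace[OF assms] good_def by metis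
  moreover have "N b < Suc (\<Sum>l\<in>(UNIV :: 'n set). CARD('p))" for b
    unfolding N_def less_Suc_eq_le by (intro sum_mono card_mono) auto
  ultimately obtain b where b: "good b" "\<And>b'. good b' \<Longrightarrow> N b' \<le> N b"
    using ex_has_greatest_nat[of good b0 N "Suc (\<Sum>l\<in>(UNIV :: 'n set). CARD('p))"] by auto
  obtain K where K: "valid v b K" "y \<notin> rhalf b K" and bC: "b \<in> rcone v" using b(1) by (auto simp: good_def)
  obtain t where t: "\<And>l. y $ l - b $ l \<le> y $ t - b $ t"
    using obtain_argmax[of "\<lambda>l. y $ l - b $ l"] by blast
  have no_raise: False if W: "W \<noteq> {}" "t \<notin> W"
    and sep: "\<And>i k. i \<in> W \<Longrightarrow> k \<notin> W \<Longrightarrow> type_set v i b \<inter> type_set v k b = {}" for W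
  proof -
    have "W \<noteq> UNIV" using W by blast
    then obtain b' where b': "\<And>i. i \<notin> W \<Longrightarrow> b' $ i = b $ i" "\<And>i. i \<in> W \<Longrightarrow> b $ i \<le> b' $ i"
      "\<And>l. type_set v l b \<subseteq> type_set v l b'" "\<exists>l. type_set v l b \<noteq> type_set v l b'"
      using raise_coordinates[OF bC W(1) _ sep] by blast
    have "b' \<in> rcone v" using bC b'(3) by (fastforce simp: rcone_def)
    moreover have "valid v b' K" using K(1) b'(3) unfolding valid_def by blast
    moreover have "y \<notin> rhalf b' K"
    proof
      assume "y \<in> rhalf b' K"
      then obtain i where i: "i \<in> K" "y $ t - b' $ t \<le> y $ i - b' $ i" by (auto simp: rhalf_def)
      moreover have "b $ i \<le> b' $ i" using b'(1,2)[of i] by (cases "i \<in> W") auto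
      ultimately have "y $ t - b $ t \<le> y $ i - b $ i" using b'(1)[OF W(2)] by linarith
      then have "y \<in> rhalf b K" using t i(1) unfolding rhalf_def by (blast intro: order_trans)
      then show False using K(2) by simp
    qed
    ultimately have "N b' \<le> N b" by (intro b(2)) (auto simp: good_def)
    moreover have "N b < N b'"
      unfolding N_def
    proof (rule sum_strict_mono_ex1)
      show "\<forall>l\<in>UNIV. card (type_set v l b) \<le> card (type_set v l b')"
        using b'(3) by (blast intro: card_mono finite)
      show "\<exists>l\<in>UNIV. card (type_set v l b) < card (type_set v l b')"
        using b'(3,4) by (metis UNIV_I finite psubsetI psubset_card_mono)
    qed simp
    ultimately show False by simp
  qed
  have "tie_connected v b"
    unfolding tie_connected_def
  proof (rule allI, intro impI, rule ccontr)
    fix W :: "'n set"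
    assume W: "W \<noteq> {}" "W \<noteq> UNIV"
      and "\<not> (\<exists>i\<in>W. \<exists>k\<in>-W. type_set v i b \<inter> type_set v k b \<noteq> {})"
    then have sep: "type_set v i b \<inter> type_set v k b = {}" if "i \<in> W" "k \<notin> W" for i k
      using that by auto
    show False
    proof (cases "t \<in> W")
      case True
      show False by (rule no_raise[of "-W"]) (use True W sep in auto)
    next
      case False
      show False by (rule no_raise[of W]) (use False W sep in auto)
    qed
  qed
  then show ?thesis using that bC K by blast
qed

text \<open>The hulls of the tie-connected apices meet only in the cone, which every hull
  contains.\<close>

lemma exists_generating:
  fixes v :: "'p::finite \<Rightarrow> real^'n"
  shows "\<exists>X. generating (frontier (tcone_proj v)) (apex_hull v) X"
proof -
  define X where "X = {proj b | b. tie_connected v b} \<inter> frontier (tcone_proj v)"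
  have "(\<Inter>c\<in>X. apex_hull v c) \<subseteq> rcone v"
  proof (rule ccontr)
    assume "\<not> ?thesis"
    then obtain y where y: "y \<in> (\<Inter>c\<in>X. apex_hull v c)" "y \<notin> rcone v" by blast
    obtain b K where b: "b \<in> rcone v" "valid v b K" "y \<notin> rhalf b K" "tie_connected v b"
      using separating_tie_connected[OF y(2)] by blast
    then have "proj b \<in> X" using apex_in_frontier by (auto simp: X_def)
    then have "y \<in> apex_hull v (proj b)" using y(1) by blast
    then show False using b by (auto simp: apex_hull_def)
  qed
  moreover have "finite X" using finite_tie_connected[of v] by (simp add: X_def)
  ultimately have "generating (frontier (tcone_proj v)) (apex_hull v) X"
    using rcone_subset_apex_hull[of v] unfolding generating_def X_def by blast
  then show ?thesis by blast
qed

text \<open>Justifies the definite description: a generating set of least cardinality is minimal,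
  and two minimal ones include each other.\<close>

lemma nonredundant_apices_generating:
  fixes v :: "'p::finite \<Rightarrow> real^'n"
  shows "apex_generating v (nonredundant_apices v)"
proof -
  let ?G = "generating (frontier (tcone_proj v)) (apex_hull v)"
  let ?M = "\<lambda>X. ?G X \<and> (\<forall>Y. ?G Y \<and> Y \<subseteq> X \<longrightarrow> Y = X)"
  have anti: "(\<Inter>d\<in>Y. apex_hull v d) \<subseteq> apex_hull v b"
    if "b \<in> frontier (tcone_proj v)" "c \<in> frontier (tcone_proj v)" "b \<noteq> c"
      "(\<Inter>d\<in>Y. apex_hull v d) \<inter> apex_hull v b = (\<Inter>d\<in>Y. apex_hull v d) \<inter> apex_hull v c" for Y b c
    using that frontier_tcone_proj_subset[of v] by (intro apex_hull_anti_exchange[of b v c Y]) auto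
  have sub: "X \<subseteq> Y" if "?M X" "?G Y" for X Y
    by (rule minimal_generating_subset[OF anti]) (use that in auto)
  obtain X0 where "?G X0" using exists_generating by blast
  then obtain X where X: "?G X" "\<And>Y. ?G Y \<Longrightarrow> card X \<le> card Y"
    using ex_has_least_nat[of ?G X0 card] by blast
  have "?M X"
  proof (intro conjI allI impI X(1))
    fix Y assume Y: "?G Y \<and> Y \<subseteq> X"
    then have "card X \<le> card Y" "finite X" using X by (auto simp: generating_def)
    then show "Y = X" using Y card_seteq by blast
  qed
  then have "\<exists>!X. ?M X" using sub by blast
  then have "?M (THE X. ?M X)" by (rule theI')
  then show ?thesis unfolding nonredundant_apices_def apex_generating_iff by blast
qed


section \<open>Vertices\<close>

lemma is_vertex_valid:
  assumes "is_vertex v I j a"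
  shows "valid v a I"
  using assms unfolding is_vertex_def valid_def by blast

text \<open>Type sets are nonempty by (C4) inside \<open>I\<close> and by (C2) outside.\<close>

lemma is_vertex_in_rcone:
  assumes "is_vertex v I j a"
  shows "a \<in> rcone v"
  unfolding rcone_def
proof (intro CollectI allI)
  fix l show "type_set v l a \<noteq> {}"
    using assms unfolding is_vertex_def by (cases "l \<in> I") blast+
qed

text \<open>The bound \<open>e\<close> covers all smaller perturbations, so finitely many apices
  admit a common one.\<close>

lemma add_axis_in_other_hull:
  fixes v :: "'p::finite \<Rightarrow> real^'n"
  assumes vertex: "is_vertex v I j a"
    and exact: "\<forall>i\<in>I. \<not> type_set v i a \<inter> type_set v j a \<subseteq> (\<Union>k\<in>UNIV - {i, j}. type_set v k a)"
    and c: "c \<in> tcone_proj v" "c \<noteq> proj a"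
  obtains e where "e > 0" "\<And>\<epsilon>. 0 < \<epsilon> \<Longrightarrow> \<epsilon> \<le> e \<Longrightarrow> a + axis j \<epsilon> \<in> apex_hull v c"
proof -
  obtain b where b: "c = proj b" "b \<in> rcone v" using c(1) by (auto simp: tcone_proj_def emb_in_tcone_iff)
  obtain k where k: "\<And>l. a $ l - b $ l \<le> a $ k - b $ k"
    using obtain_argmax[of "\<lambda>l. a $ l - b $ l"] by blast
  define M where "M = a $ k - b $ k"
  have a: "a \<in> rcone v" by (rule is_vertex_in_rcone[OF vertex])
  \<comment> \<open>If \<open>j\<close> does not maximize \<open>a - b\<close>, the perturbation may
    at most close the gap to the maximum; otherwise any positive bound would do.\<close>
  define e where "e = (if a $ j - b $ j < M then M - (a $ j - b $ j) else 1)"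
  have "e > 0" by (simp add: e_def)
  moreover have "a + axis j \<epsilon> \<in> apex_hull v c" if \<epsilon>: "0 < \<epsilon>" "\<epsilon> \<le> e" for \<epsilon>
    unfolding apex_hull_def
  proof (intro CollectI allI impI)
    fix b' K assume "proj b' = c" and K: "valid v b' K"
    then obtain t where t: "\<And>i. b $ i = t + b' $ i" using b(1) proj_eq_iff by metis
    have types: "type_set v l b = type_set v l b'" for l by (rule type_set_shift[OF t])
    show "a + axis j \<epsilon> \<in> rhalf b' K"
    proof (cases "a $ j - b $ j < M")
      case True
      obtain i where i: "i \<in> K" "\<And>l. a $ l - b' $ l \<le> a $ i - b' $ i"
        using rcone_subset_rhalf[OF K] a by (auto simp: rhalf_def)
      have "(a + axis j \<epsilon>) $ l - b' $ l \<le> (a + axis j \<epsilon>) $ i - b' $ i" for l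
        using i(2)[of l] i(2)[of k] \<epsilon> True t[of k] t[of i] t[of j]
        by (auto simp: axis_def e_def M_def)
      then show ?thesis using i(1) by (auto simp: rhalf_def)
    next
      case False
      \<comment> \<open>Here the perturbation makes \<open>j\<close> the unique maximizer, so
        everything hinges on \<open>j\<close> being in \<open>K\<close>.\<close>
      then have j: "a $ j - b $ j = M" using k[of j] by (simp add: M_def)
      have "j \<in> K"
      proof (rule ccontr)
        assume jK: "j \<notin> K"
        have I: "a $ i - b $ i = M" if "i \<in> I" for i
        proof -
          \<comment> \<open>This generator is tied at \<open>i\<close> and \<open>j\<close> only.
            Its maximizing index \<open>q\<close> in \<open>K\<close> relative to \<open>b\<close>
            must maximize \<open>a - b\<close> and belong to the tie, hence is
            \<open>i\<close>.\<close>
          from exact that obtain r where r: "r \<in> type_set v i a" "r \<in> type_set v j a"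
            and only: "\<And>k. k \<noteq> i \<Longrightarrow> k \<noteq> j \<Longrightarrow> r \<notin> type_set v k a"
            by blast
          obtain q where q: "q \<in> K" "r \<in> type_set v q b" using K unfolding valid_def types by blast
          have "v r $ j - b $ j \<le> v r $ q - b $ q" using q by (auto simp: type_set_def)
          moreover have "v r $ q - a $ q \<le> v r $ j - a $ j" using r by (auto simp: type_set_def)
          moreover have "a $ q - b $ q \<le> M" using k by (simp add: M_def)
          ultimately have q_eq: "a $ q - b $ q = M" "v r $ q - a $ q = v r $ j - a $ j"
            using j by linarith+
          then have "r \<in> type_set v q a" using r(2) by (simp add: type_set_def)
          then have "q = i" using only q(1) jK by blast
          then show ?thesis using q_eq by simp
        qed
        \<comment> \<open>At this \<open>i\<close> the difference \<open>a - b\<close> is minimal,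
          yet equal to its maximum \<open>M\<close>, so it is constant.\<close>
        obtain i where i: "i \<in> I" "\<And>l. b $ l - a $ l \<le> b $ i - a $ i"
          using rcone_subset_rhalf[OF is_vertex_valid[OF vertex]] b(2) by (auto simp: rhalf_def)
        have "a $ l = M + b $ l" for l using k[of l] i(2)[of l] I[OF i(1)] by (simp add: M_def)
        then have "proj b = proj a" unfolding proj_eq_iff by blast
        then show False using c b by simp
      qed
      moreover have "(a + axis j \<epsilon>) $ l - b' $ l \<le> (a + axis j \<epsilon>) $ j - b' $ j" for l
        using k[of l] j \<epsilon> t[of l] t[of j] by (auto simp: axis_def M_def)
      ultimately show ?thesis unfolding rhalf_def by blast
    qed
  qed
  ultimately show ?thesis using that by blast
qed

theorem theorem8:
  fixes v :: "'p::finite \<Rightarrow> real^'n" and a :: "real^'n" and I :: "'n set" and j :: 'n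
  assumes "is_vertex v I j a"
    and "\<forall>i\<in>I. \<not> type_set v i a \<inter> type_set v j a \<subseteq> (\<Union>k\<in>UNIV - {i, j}. type_set v k a)"
  shows "proj a \<in> nonredundant_apices v"
proof (rule ccontr)
  define X where "X = nonredundant_apices v"
  assume "proj a \<notin> nonredundant_apices v"
  then have aX: "proj a \<notin> X" by (simp add: X_def)
  have X: "finite X" "X \<subseteq> frontier (tcone_proj v)"
    "\<And>b. b \<in> frontier (tcone_proj v) \<Longrightarrow> (\<Inter>c\<in>X. apex_hull v c) \<subseteq> apex_hull v b"
    using nonredundant_apices_generating[of v] unfolding apex_generating_iff generating_def X_def by auto
  have valid: "valid v a I" by (rule is_vertex_valid[OF assms(1)])
  have "\<exists>e>0. \<forall>\<epsilon>. 0 < \<epsilon> \<longrightarrow> \<epsilon> \<le> e \<longrightarrow> a + axis j \<epsilon> \<in> apex_hull v c" if "c \<in> X" for c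
  proof -
    have "c \<in> tcone_proj v" "c \<noteq> proj a" using that X(2) aX frontier_tcone_proj_subset by auto
    then show ?thesis using add_axis_in_other_hull[OF assms] by metis
  qed
  then obtain e where e: "\<And>c. c \<in> X \<Longrightarrow> e c > 0"
    "\<And>c \<epsilon>. c \<in> X \<Longrightarrow> 0 < \<epsilon> \<Longrightarrow> \<epsilon> \<le> e c \<Longrightarrow> a + axis j \<epsilon> \<in> apex_hull v c" by metis
  \<comment> \<open>Inserting 1 keeps the minimum meaningful for empty \<open>X\<close>.\<close>
  define \<epsilon> where "\<epsilon> = Min (insert 1 (e ` X))"
  have "\<epsilon> > 0" "\<And>c. c \<in> X \<Longrightarrow> \<epsilon> \<le> e c" using X(1) e(1) by (auto simp: \<epsilon>_def)
  then have "a + axis j \<epsilon> \<in> (\<Inter>c\<in>X. apex_hull v c)" using e(2) by blast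
  also have "\<dots> \<subseteq> apex_hull v (proj a)"
    using X(3) apex_in_frontier[OF is_vertex_in_rcone[OF assms(1)] valid] by blast
  also have "\<dots> \<subseteq> rhalf a I" using valid by (auto simp: apex_hull_def)
  finally show False
    using add_axis_notin_rhalf[of \<epsilon> j I a] \<open>\<epsilon> > 0\<close> assms(1) by (auto simp: is_vertex_def)
qed

end
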